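(* For every positive integer $d$ there is a constant $C_d > 0$ depending only on $d$ such that the following holds. Let $p$ be a prime, let $a_1,\dots,a_d \in \mathbb{F}_p \setminus \{0\}$ and let $\eta_1,\dots,\eta_d \in (0,1/2)$. Put $\Gamma = (a_1,\dots,a_d)$ and $\eta = (\eta_1,\dots,\eta_d)$, and let $B = B(\Gamma,\eta)$, $t = t(\Gamma,\eta)$ and $\delta = \delta(\Gamma,\eta)$ be the Bohr set and the two quantities defined in the context. Then $$|B| \leq C_d\, \delta^{\,t-d}\, (\eta_1 \cdots \eta_d)\, p.$$
   Context: Let $\|\cdot\|$ denote the distance to the nearest integer. Elements $a_i \in \mathbb{F}_p$ are identified with integer representatives where needed. For $\Gamma = (a_1,\dots,a_d)$ with $a_i \in \mathbb{F}_p\setminus\{0\}$ and $\eta = (\eta_1,\dots,\eta_d)$ with $\eta_i \in (0,1/2)$: - The Bohr set is $B(\Gamma,\eta) := \{x \in \mathbb{F}_p : \|a_i x/p\| \leq \eta_i \text{ for each } 1 \leq i \leq d\}$. - Define the box $R_\eta = [-\eta_1,\eta_1] \times \cdots \times [-\eta_d,\eta_d] \subset \mathbb{R}^d$ and the lattice $L_\Gamma = \mathbb{Z}^d + \{p^{-1}(a_1x,\dots,a_dx) : x \in \mathbb{Z}\} \subset \mathbb{R}^d$. Then $t(\Gamma,\eta)$ is the largest integer $t$ with $0 \le t \le d$ such that there are $t$ linearly independent (over $\mathbb{R}$) vectors in $R_\eta \cap L_\Gamma$. - $\delta(\Gamma,\eta)$ is the supremum of all real numbers $\delta$ such that the system $$a_1u_1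 + \cdots + a_du_d \equiv 0 \pmod p, \qquad u_i \in \mathbb{Z} \text{ and } |u_i| \leq \delta/\eta_i \text{ for each } 1 \leq i \leq d$$ has only the trivial solution $u_1 = \cdots = u_d = 0$. (One has $\min_i \eta_i \leq \delta(\Gamma,\eta) \leq p \max_i \eta_i$, so $\delta(\Gamma,\eta)$ is a positive real number.) *)

theory Defs
  imports "HOL-Analysis.Analysis" "HOL-Number_Theory.Residues"
begin

text \<open>
  \<open>\<bbbF>\<^sub>p\<close> is the library ring \<^term>\<open>residue_ring (int p)\<close>, whose carrier
  \<open>{0..p - 1}\<close> consists of integers; its elements are thus their own integer representatives.
  The index type \<open>'d\<close> plays the role of \<open>{1..d}\<close>, with \<open>d = CARD('d) \<ge> 1\<close>.
\<close>

definition dist_nearest_int :: "real \<Rightarrow> real" where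
  "dist_nearest_int x = \<bar>x - of_int (round x)\<bar>"

definition bohr_set :: "nat \<Rightarrow> int ^ 'd \<Rightarrow> real ^ 'd \<Rightarrow> int set" where
  "bohr_set p a \<eta> = {x \<in> carrier (residue_ring (int p)).
     \<forall>i. dist_nearest_int (real_of_int (a $ i * x) / real p) \<le> \<eta> $ i}"

definition bohr_box :: "real ^ 'd \<Rightarrow> (real ^ 'd) set" where
  "bohr_box \<eta> = cbox (- \<eta>) \<eta>"

definition bohr_lattice :: "nat \<Rightarrow> int ^ 'd \<Rightarrow> (real ^ 'd) set" where
  "bohr_lattice p a =
     {(\<chi> i. real_of_int (z $ i)) + (\<chi> i. real_of_int (a $ i * x) / real p) | (z :: int ^ 'd) (x :: int). True}"

definition bohr_t :: "nat \<Rightarrow> int ^ 'd \<Rightarrow> real ^ 'd \<Rightarrow> nat" where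
  "bohr_t p a \<eta> = Max {t. t \<le> CARD('d) \<and>
     (\<exists>S. finite S \<and> card S = t \<and> S \<subseteq> bohr_box \<eta> \<inter> bohr_lattice p a \<and> independent S)}"

definition bohr_delta :: "nat \<Rightarrow> int ^ 'd \<Rightarrow> real ^ 'd \<Rightarrow> real" where
  "bohr_delta p a \<eta> = Sup {\<delta> :: real. \<forall>u :: int ^ 'd.
     [(\<Sum>i\<in>UNIV. a $ i * u $ i) = 0] (mod int p) \<and> (\<forall>i. \<bar>real_of_int (u $ i)\<bar> \<le> \<delta> / \<eta> $ i)
     \<longrightarrow> u = 0}"

end

theory Submission
  imports Defs
begin

text \<open>
  The Bohr set injects into \<open>A\<close>, the intersection of the box \<open>R\<close> with the lattice \<open>L\<close>, which has
  dimension \<open>t\<close>. Two estimates for lattice points in a dilate of \<open>R\<close> by \<open>\<kappa> \<asymp> 1 / \<delta>\<close> are played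
  off against each other. On the one hand \<open>L\<close> has at least \<open>c |A| \<kappa>\<^sup>t\<close> points in it, as \<open>A\<close>
  behaves like a convex body of dimension \<open>t\<close>. On the other hand, the dual lattice, which consists
  of all integer vectors \<open>u\<close> with \<open>a \<cdot> u \<equiv> 0\<close> modulo \<open>p\<close>, has no nonzero point with
  \<open>|u\<^sub>i| \<le> \<delta> / (2 \<eta>\<^sub>i)\<close>. A large sieve argument (Parseval for the exponential sum over the lattice
  points, which is large near each point of the dual lattice) then shows that there are at most
  \<open>C \<delta>\<^sup>-\<^sup>d (\<eta>\<^sub>1 \<dots> \<eta>\<^sub>d) p\<close> such points.
\<close>

section \<open>Exponential sums modulo \<open>q\<close>: orthogonality and Parseval's
  identity\<close>

text \<open>A geometric series in the root of unity \<open>z\<close>, which equals 1 exactly when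
  \<open>q\<close> divides \<open>k\<close>.\<close>

lemma sum_cis_residues:
  fixes q :: nat and k :: int
  assumes "q > 0"
  shows "(\<Sum>w\<in>{0..<int q}. cis (2 * pi * (of_int w * of_int k / real q))) = (if int q dvd k then of_nat q else 0)"
proof -
  define z where "z = cis (2 * pi * (of_int k / real q))"
  have zp: "z ^ n = cis (2 * pi * (real n * of_int k / real q))" for n
    by (simp add: z_def Complex.DeMoivre mult_ac)
  have "(\<Sum>w\<in>{0..<int q}. cis (2 * pi * (of_int w * of_int k / real q))) = (\<Sum>n<q. z ^ n)"
    unfolding zp
    by (rule sum.reindex_bij_witness[of _ int nat]) auto
  also have "\<dots> = (if int q dvd k then of_nat q else 0)"
  proof (cases "int q dvd k")
    case True
    then obtain j where "k = int q * j" by (elim dvdE)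
    then have "z = 1" using assms cis_multiple_2pi[of "of_int j"] by (simp add: z_def)
    then show ?thesis using True by simp
  next
    case False
    have "z \<noteq> 1"
    proof
      assume "z = 1"
      then have "exp (\<i> * (2 * pi * (of_int k / real q))) = 1"
        by (simp add: z_def cis_conv_exp)
      then obtain n :: int where "2 * pi * (of_int k / real q) = of_int (2 * n) * pi"
        unfolding exp_eq_1 by auto
      then have "real_of_int k = of_int n * real q"
        using assms by (simp add: field_simps)
      then have "k = n * int q"
        by (metis of_int_eq_iff of_int_mult of_int_of_nat_eq)
      then show False using False by simp
    qed
    moreover have "z ^ q = 1"
      unfolding zp using assms cis_multiple_2pi[of "of_int k"] by simp
    ultimately show ?thesis using False by (simp add: geometric_sum)
  qed
  finally show ?thesis .
qed

text \<open>After expanding the square, the sum over \<open>w\<close> for a pair \<open>x\<close>,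
  \<open>y\<close> factors over the coordinates into complete character sums modulo
  \<open>q\<close>. If \<open>x \<noteq> y\<close>, some coordinate of \<open>k x - k y\<close> is
  nonzero modulo \<open>q\<close> and its factor vanishes, so only the diagonal survives.\<close>

lemma parseval_residues:
  fixes k :: "'a \<Rightarrow> 'd::finite \<Rightarrow> int" and q :: nat
  assumes q: "q > 0" and X: "finite X"
    and inj: "\<And>x y. \<lbrakk>x \<in> X; y \<in> X; \<And>i. int q dvd k x i - k y i\<rbrakk> \<Longrightarrow> x = y"
  shows "(\<Sum>w\<in>(UNIV :: 'd set) \<rightarrow>\<^sub>E {0..<int q}. (cmod (\<Sum>x\<in>X. cis (2 * pi * (\<Sum>i\<in>UNIV. of_int (w i) * of_int (k x i) / real q))))\<^sup>2)
    = real q ^ CARD('d) * real (card X)"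
proof -
  let ?Q = "(UNIV :: 'd set) \<rightarrow>\<^sub>E {0..<int q}"
  let ?\<theta> = "\<lambda>w x. 2 * pi * (\<Sum>i\<in>UNIV. of_int (w i) * of_int (k x i) / real q)"
  have orth: "(\<Sum>w\<in>?Q. cis (?\<theta> w x - ?\<theta> w y)) = (if x = y then of_nat q ^ CARD('d) else 0)"
    if xy: "x \<in> X" "y \<in> X" for x y
  proof -
    have "cis (?\<theta> w x - ?\<theta> w y) = (\<Prod>i\<in>UNIV. cis (2 * pi * (of_int (w i) * of_int (k x i - k y i) / real q)))" for w
    proof -
      have cis_sum: "cis (\<Sum>i\<in>S. f i) = (\<Prod>i\<in>S. cis (f i))" if "finite S" for S :: "'d set" and f
        using that by (induction S rule: finite_induct) (simp_all flip: cis_mult)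
      show ?thesis
        unfolding cis_sum[OF finite, symmetric] sum_distrib_left sum_subtractf [symmetric]
        by (intro arg_cong[of _ _ cis] sum.cong refl) (simp add: right_diff_distrib diff_divide_distrib)
    qed
    then have "(\<Sum>w\<in>?Q. cis (?\<theta> w x - ?\<theta> w y)) =
        (\<Prod>i\<in>(UNIV::'d set). \<Sum>w\<in>{0..<int q}. cis (2 * pi * (of_int w * of_int (k x i - k y i) / real q)))"
      by (subst prod_sum_PiE) auto
    also have "\<dots> = (\<Prod>i\<in>(UNIV::'d set). if int q dvd k x i - k y i then of_nat q else 0)"
      unfolding sum_cis_residues[OF q] ..
    also have "\<dots> = (if x = y then of_nat q ^ CARD('d) else 0)"
    proof (cases "x = y")
      case False
      then obtain i where "\<not> int q dvd k x i - k y i" using inj xy by blast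
      then show ?thesis using False by (auto intro!: prod_zero)
    qed simp
    finally show ?thesis .
  qed
  have "complex_of_real (\<Sum>w\<in>?Q. (cmod (\<Sum>x\<in>X. cis (?\<theta> w x)))\<^sup>2)
      = (\<Sum>w\<in>?Q. (\<Sum>x\<in>X. cis (?\<theta> w x)) * cnj (\<Sum>y\<in>X. cis (?\<theta> w y)))"
    by (simp only: of_real_sum complex_norm_square)
  also have "\<dots> = (\<Sum>w\<in>?Q. \<Sum>x\<in>X. \<Sum>y\<in>X. cis (?\<theta> w x - ?\<theta> w y))"
    by (simp only: cnj_sum cis_cnj sum_product cis_mult diff_conv_add_uminus)
  also have "\<dots> = (\<Sum>x\<in>X. \<Sum>y\<in>X. \<Sum>w\<in>?Q. cis (?\<theta> w x - ?\<theta> w y))"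
    by (subst sum.swap, rule sum.cong[OF refl], rule sum.swap)
  also have "\<dots> = (\<Sum>x\<in>X. \<Sum>y\<in>X. if x = y then of_nat q ^ CARD('d) else 0)"
    by (intro sum.cong refl orth)
  also have "\<dots> = complex_of_real (real q ^ CARD('d) * real (card X))"
    using X by simp
  finally show ?thesis by (simp only: of_real_eq_iff)
qed

section \<open>Determinants and a basis with bounded coordinates\<close>

text \<open>The determinant criterion for independence, phrased for an indexed family so that a
  repeated vector counts as a dependency.\<close>

lemma det_rows_nonzero_iff:
  fixes v :: "'d::finite \<Rightarrow> real ^ 'd"
  shows "det (\<chi> i. v i) \<noteq> 0 \<longleftrightarrow> (\<forall>f. (\<Sum>i\<in>UNIV. f i *\<^sub>R v i) = 0 \<longrightarrow> (\<forall>i. f i = 0))"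
proof -
  have "row i (\<chi> i. v i) = v i" for i
    by (simp add: row_def)
  then show ?thesis
    using matrix_right_invertible_independent_rows[of "\<chi> i. v i"]
      invertible_det_nz[of "\<chi> i. v i"] invertible_right_inverse[of "\<chi> i. v i"]
    by (simp only: scalar_mult_eq_scaleR)
qed

text \<open>
  The basis is chosen to maximise the absolute value of the determinant; by Cramer's rule no
  element of \<open>A\<close> then has a coordinate exceeding 1.
\<close>
lemma ex_basis_unit_coordinates:
  fixes A :: "(real ^ 'd) set"
  assumes A: "finite A"
  obtains T and v :: "'d \<Rightarrow> real ^ 'd" and c :: "real ^ 'd \<Rightarrow> 'd \<Rightarrow> real"
  where "card T = dim A" "\<forall>i\<in>T. v i \<in> A"
    "\<forall>x\<in>A. x = (\<Sum>i\<in>T. c x i *\<^sub>R v i)"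
    "\<forall>x\<in>A. \<forall>i\<in>T. \<bar>c x i\<bar> \<le> 1"
    "\<forall>f. (\<Sum>i\<in>T. f i *\<^sub>R v i) = 0 \<longrightarrow> (\<forall>i\<in>T. f i = 0)"
proof -
  obtain B where B: "B \<subseteq> A" "independent B" "A \<subseteq> span B" "card B = dim A"
    by (rule basis_exists)
  obtain E where E: "B \<subseteq> E" "independent E" "UNIV \<subseteq> span E"
    by (rule maximal_independent_subset_extend[OF subset_UNIV B(2)])
  have "card E = CARD('d)" "finite E"
    using basis_card_eq_dim[OF subset_UNIV E(3,2)] E(2) by (auto simp: dim_UNIV finiteI_independent)
  then obtain h :: "'d \<Rightarrow> real ^ 'd" where h: "bij_betw h UNIV E"
    by (metis bij_betw_iff_card finite)
  define T where "T = h -` B"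
  have hT: "bij_betw h T B"
    using h E(1) unfolding T_def bij_betw_def by (auto intro: inj_on_subset)
  \<comment> \<open>Positions in \<open>T\<close> range over \<open>A\<close>, while the others keep
    the vectors that complete the basis. Thus a determinant of full size is available even if
    \<open>A\<close> does not span the space.\<close>
  define F where "F = PiE (UNIV :: 'd set) (\<lambda>i. if i \<in> T then A else {h i})"
  have F: "v \<in> F \<longleftrightarrow> (\<forall>i. v i \<in> (if i \<in> T then A else {h i}))" for v
    by (simp add: F_def PiE_UNIV_domain Pi_iff)
  have finF: "finite F"
    unfolding F_def using A by (intro finite_PiE) auto
  have hF: "h \<in> F"
    using B(1) by (auto simp: F T_def)
  define D where "D v = \<bar>det (\<chi> i. v i)\<bar>" for v :: "'d \<Rightarrow> real ^ 'd"
  have "Max (D ` F) \<in> D ` F"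
    using finF hF by (intro Max_in) auto
  then obtain v where v: "v \<in> F" "Max (D ` F) = D v"
    by auto
  have max: "D w \<le> D v" if "w \<in> F" for w
    using that finF v(2) by (metis Max_ge finite_imageI imageI)
  \<comment> \<open>The family \<open>h\<close> enumerates a basis and lies in \<open>F\<close>, so
    the maximum of \<open>D\<close> is positive.\<close>
  have "det (\<chi> i. h i) \<noteq> 0"
    unfolding det_rows_nonzero_iff
  proof (intro allI impI)
    fix f i assume 0: "(\<Sum>i\<in>UNIV. f i *\<^sub>R h i) = 0"
    have "(\<Sum>e\<in>E. f (inv_into UNIV h e) *\<^sub>R e) = (\<Sum>i\<in>UNIV. f i *\<^sub>R h i)"
      using h by (subst sum.reindex_bij_betw[OF h, symmetric]) (simp add: bij_betw_def)
    then have "f (inv_into UNIV h (h i)) = 0"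
      using independentD[OF E(2) \<open>finite E\<close> order_refl, of "\<lambda>e. f (inv_into UNIV h e)" "h i"] 0 h
      by (auto simp: bij_betw_def)
    then show "f i = 0"
      using h by (simp add: bij_betw_def)
  qed
  then have Dv: "D v > 0"
    using max[OF hF] by (auto simp: D_def)
  have indep: "f i = 0" if "(\<Sum>i\<in>T. f i *\<^sub>R v i) = 0" "i \<in> T" for f i
  proof -
    have "(\<Sum>i\<in>UNIV. (if i \<in> T then f i else 0) *\<^sub>R v i) = (\<Sum>i\<in>T. f i *\<^sub>R v i)"
      by (rule sum.mono_neutral_cong_right) auto
    moreover have "(\<Sum>i\<in>UNIV. f i *\<^sub>R v i) = 0 \<Longrightarrow> f i = 0" for f i
      using Dv unfolding D_def zero_less_abs_iff det_rows_nonzero_iff by blast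
    from this[of "\<lambda>i. if i \<in> T then f i else 0" i]
    have "(\<Sum>i\<in>UNIV. (if i \<in> T then f i else 0) *\<^sub>R v i) = 0 \<Longrightarrow> (if i \<in> T then f i else 0) = 0" .
    ultimately have "(if i \<in> T then f i else 0) = 0"
      using that(1) by simp
    then show ?thesis
      using that(2) by simp
  qed
  have inj: "inj_on v T"
  proof (rule inj_onI, rule ccontr)
    fix i j assume ij: "i \<in> T" "j \<in> T" "v i = v j" "i \<noteq> j"
    let ?f = "\<lambda>k. of_bool (k = i) - of_bool (k = j) :: real"
    have "(\<Sum>k\<in>T. ?f k *\<^sub>R v k) = v i - v j"
    proof -
      have "(\<Sum>k\<in>T. of_bool (k = l) *\<^sub>R v k) = v l" if "l \<in> T" for l
        using that by (subst sum.remove[of _ l]) (auto intro: sum.neutral)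
      then show ?thesis
        using ij by (simp only: scaleR_left_diff_distrib sum_subtractf)
    qed
    then have "?f i = 0"
      using ij by (intro indep) auto
    with ij show False by simp
  qed
  have "independent (v ` T)"
    unfolding independent_explicit
  proof (intro conjI allI impI ballI)
    fix f x assume 0: "(\<Sum>x\<in>v ` T. f x *\<^sub>R x) = 0" and "x \<in> v ` T"
    then show "f x = 0"
      using indep[of "\<lambda>i. f (v i)"] by (auto simp: sum.reindex[OF inj])
  qed simp
  moreover have vA: "v i \<in> A" if "i \<in> T" for i
    using v(1) that unfolding F by presburger
  moreover have card: "card T = dim A"
    using hT B(4) by (simp add: bij_betw_same_card)
  ultimately have span: "A \<subseteq> span (v ` T)"
    by (intro card_ge_dim_independent) (auto simp: card_image[OF inj])
  have "\<exists>c. x = (\<Sum>i\<in>T. c i *\<^sub>R v i)" if "x \<in> A" for x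
  proof -
    have "x \<in> span (v ` T)" using span that by auto
    then obtain u where "x = (\<Sum>y\<in>v ` T. u y *\<^sub>R y)"
      by (auto simp: span_finite)
    then show ?thesis
      by (auto simp: sum.reindex[OF inj] intro!: exI[of _ "\<lambda>i. u (v i)"])
  qed
  then obtain c where c: "x = (\<Sum>i\<in>T. c x i *\<^sub>R v i)" if "x \<in> A" for x
    by metis
  have "\<bar>c x k\<bar> \<le> 1" if "x \<in> A" "k \<in> T" for x k
  proof -
    \<comment> \<open>\<open>C\<close> pads the coordinates of \<open>x\<close> with 0 at the
      completing vectors, as Cramer's rule needs all of them. Putting \<open>x\<close> in position
      \<open>k\<close> gives a family in \<open>F\<close> again, so the determinant cannot grow in
      absolute value.\<close>
    define C where "C = (\<chi> i. if i \<in> T then c x i else 0)"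
    have x: "x = (\<Sum>i\<in>UNIV. C $ i *s v i)"
      unfolding scalar_mult_eq_scaleR
      by (subst c[OF that(1)], rule sum.mono_neutral_cong_left) (auto simp: C_def)
    have row: "row i (\<chi> i. v i) = v i" for i
      by (simp add: row_def)
    have "det (\<chi> i. (v(k := x)) i) = C $ k * det (\<chi> i. v i)"
      using cramer_lemma_transpose[of k C "\<chi> i. v i"]
      unfolding row x [symmetric] by (simp only: fun_upd_def)
    then have "D (v(k := x)) = \<bar>c x k\<bar> * D v"
      using that by (simp add: D_def abs_mult C_def)
    moreover have "v i = h i" if "i \<notin> T" for i
      using v(1) that unfolding F by (metis singletonD)
    then have "v(k := x) \<in> F"
      using vA that by (auto simp: F)
    ultimately show ?thesis
      using max Dv by fastforce
  qed
  with card vA c indep show ?thesis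
    by (intro that[of T v c]) blast+
qed

section \<open>Lower bound for the number of lattice points in a dilated box\<close>

lemma abs_diff_less_if_floor_eq:
  fixes x y e :: real
  assumes "e > 0" "\<lfloor>x / e\<rfloor> = \<lfloor>y / e\<rfloor>"
  shows "\<bar>x - y\<bar> < e"
proof -
  have "\<bar>x / e - y / e\<bar> < 1"
    using assms(2) by linarith
  then show ?thesis
    using assms(1) by (simp add: diff_divide_distrib [symmetric] abs_divide divide_less_eq)
qed

text \<open>
  By pigeonhole a positive proportion of \<open>A\<close> lies in one cell of side \<open>\<epsilon> = min 1 (\<kappa> / d)\<close> of the
  coordinates above. Differences within this cell, translated by the combinations of the basis
  vectors with coefficients in \<open>{0..<n}\<close>, are pairwise distinct because \<open>\<epsilon> \<le> 1\<close>.
\<close>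
lemma ex_dilated_subset:
  fixes L A :: "(real ^ 'd) set" and \<eta> :: "real ^ 'd" and \<kappa> :: real
  assumes diff: "\<And>x y. \<lbrakk>x \<in> L; y \<in> L\<rbrakk> \<Longrightarrow> x - y \<in> L"
    and A: "finite A" "A \<subseteq> L" "\<And>x i. x \<in> A \<Longrightarrow> \<bar>x $ i\<bar> \<le> \<eta> $ i"
    and \<kappa>: "\<kappa> > 0"
  obtains X where "finite X" "X \<subseteq> L" "\<And>x i. x \<in> X \<Longrightarrow> \<bar>x $ i\<bar> \<le> \<kappa> * \<eta> $ i"
    "real (card A) * (\<kappa> / (8 * real CARD('d))) ^ dim A \<le> real (card X)"
proof (cases "A = {}")
  case True
  then show ?thesis by (intro that[of "{}"]) auto
next
  case False
  obtain T and v :: "'d \<Rightarrow> real ^ 'd" and c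
    where T: "card T = dim A" and v: "\<forall>i\<in>T. v i \<in> A"
      and c: "\<forall>x\<in>A. x = (\<Sum>i\<in>T. c x i *\<^sub>R v i)"
      and c1: "\<forall>x\<in>A. \<forall>i\<in>T. \<bar>c x i\<bar> \<le> 1"
      and indep: "\<forall>f. (\<Sum>i\<in>T. f i *\<^sub>R v i) = 0 \<longrightarrow> (\<forall>i\<in>T. f i = 0)"
    by (rule ex_basis_unit_coordinates[OF A(1)])
  define d where "d = real CARD('d)"
  have d: "d \<ge> 1" by (simp add: d_def Suc_le_eq)
  \<comment> \<open>The coefficients used below are at most \<open>\<epsilon> + (n - 1)\<close> in
    absolute value. The choice of \<open>\<epsilon>\<close> and \<open>n\<close> keeps this below
    \<open>\<kappa> / d\<close>, so that a combination of at most \<open>d\<close> basis vectors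
    stays in the dilated box, while \<open>\<epsilon> * n\<close> is still at least half of
    \<open>\<kappa> / d\<close>.\<close>
  define \<epsilon> where "\<epsilon> = min 1 (\<kappa> / d)"
  define n where "n = max 1 (nat \<lfloor>\<kappa> / d\<rfloor>)"
  have \<epsilon>: "0 < \<epsilon>" "\<epsilon> \<le> 1"
    using \<kappa> d by (auto simp: \<epsilon>_def)
  have "\<kappa> / d > 0" using \<kappa> d by simp
  then have n: "n \<ge> 1" "\<epsilon> + (real n - 1) \<le> \<kappa> / d" "\<kappa> / d \<le> 2 * (\<epsilon> * real n)"
    unfolding n_def \<epsilon>_def
    by (cases "\<kappa> / d < 1"; simp add: min_def max_def; linarith)+
  have L0: "0 \<in> L"
    using False A(2) diff by (metis all_not_in_conv diff_self subsetD)
  have Ladd: "x + y \<in> L" if "x \<in> L" "y \<in> L" for x y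
    using diff[OF that(1) diff[OF L0 that(2)]] by simp
  have Lmult: "real k *\<^sub>R x \<in> L" if "x \<in> L" for k x
    using that by (induction k) (auto simp: L0 Ladd scaleR_add_left)
  have Lsum: "(\<Sum>i\<in>S. f i) \<in> L" if "finite S" "\<And>i. i \<in> S \<Longrightarrow> f i \<in> L" for S and f :: "'d \<Rightarrow> _"
    using that by (induction S rule: finite_induct) (auto simp: L0 Ladd)

  let ?I = "{\<lfloor>- (1 / \<epsilon>)\<rfloor>..\<lfloor>1 / \<epsilon>\<rfloor>}"
  define cell where "cell x = (\<lambda>i\<in>T. \<lfloor>c x i / \<epsilon>\<rfloor>)" for x
  have cell: "cell \<in> A \<rightarrow> T \<rightarrow>\<^sub>E ?I"
  proof (intro Pi_I PiE_I)
    fix x i assume "x \<in> A" "i \<in> T"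
    then have "\<bar>c x i\<bar> \<le> 1" using c1 by blast
    then have "(- 1) / \<epsilon> \<le> c x i / \<epsilon>" "c x i / \<epsilon> \<le> 1 / \<epsilon>"
      using \<epsilon>(1) by (intro divide_right_mono; simp)+
    then show "cell x i \<in> ?I"
      using \<open>i \<in> T\<close> by (auto simp: cell_def intro!: floor_mono)
  qed (auto simp: cell_def)
  \<comment> \<open>Ensures that there is a cell at all, as the pigeonhole principle
    requires.\<close>
  have "0 \<in> ?I"
  proof -
    have "1 / \<epsilon> > 0" using \<epsilon>(1) by simp
    then have "\<lfloor>- (1 / \<epsilon>)\<rfloor> \<le> 0" "0 \<le> \<lfloor>1 / \<epsilon>\<rfloor>" by linarith+
    then show ?thesis by (simp only: atLeastAtMost_iff)
  qed
  have fincell: "finite (T \<rightarrow>\<^sub>E ?I)"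
    by (intro finite_PiE) auto
  have "(\<lambda>i\<in>T. 0) \<in> T \<rightarrow>\<^sub>E ?I"
    using \<open>0 \<in> ?I\<close> by auto
  then obtain y where y: "card A \<le> card (cell -` {y} \<inter> A) * card (T \<rightarrow>\<^sub>E ?I)"
    using pigeonhole_card[OF cell A(1) fincell] by blast
  define A' where "A' = cell -` {y} \<inter> A"
  have A': "A' \<subseteq> A" "finite A'" using A(1) by (auto simp: A'_def)
  have cardI: "real (card ?I) \<le> 4 / \<epsilon>"
  proof -
    have "0 \<le> \<lfloor>1 / \<epsilon>\<rfloor> - \<lfloor>- (1 / \<epsilon>)\<rfloor> + 1"
      using \<open>0 \<in> ?I\<close> unfolding atLeastAtMost_iff by linarith
    then have "real (card ?I) = of_int (\<lfloor>1 / \<epsilon>\<rfloor> - \<lfloor>- (1 / \<epsilon>)\<rfloor> + 1)"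
      by (simp only: card_atLeastAtMost_int of_nat_nat)
    also have "\<dots> \<le> 2 * (1 / \<epsilon>) + 2" by linarith
    also have "\<dots> \<le> 4 * (1 / \<epsilon>)" using \<epsilon> by (simp add: field_simps)
    finally show ?thesis by simp
  qed
  have "real (card A) \<le> real (card A') * real (card ?I) ^ dim A"
    using y by (simp add: A'_def card_PiE T flip: of_nat_mult of_nat_power)
  also have "\<dots> \<le> real (card A') * (4 / \<epsilon>) ^ dim A"
    using cardI by (intro mult_left_mono power_mono) auto
  finally have A'_card: "real (card A) * (\<epsilon> / 4) ^ dim A \<le> real (card A')"
    using \<epsilon>(1) by (simp add: power_divide field_simps)
  moreover have "real (card A) * (\<epsilon> / 4) ^ dim A > 0"
    using False A(1) \<epsilon>(1) by (simp add: card_gt_0_iff)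
  ultimately have "card A' \<noteq> 0" by linarith
  then obtain a0 where a0: "a0 \<in> A'" by force
  have close: "\<bar>c a i - c b i\<bar> < \<epsilon>" if "a \<in> A'" "b \<in> A'" "i \<in> T" for a b i
  proof -
    have "cell a i = cell b i" using that by (auto simp: A'_def)
    then show ?thesis
      using that(3) by (intro abs_diff_less_if_floor_eq[OF \<epsilon>(1)]) (simp add: cell_def)
  qed

  define M where "M = T \<rightarrow>\<^sub>E {..<n}"
  define g where "g = (\<lambda>(a, m). a - a0 + (\<Sum>i\<in>T. real (m i) *\<^sub>R v i))"
  have g: "g (a, m) = (\<Sum>i\<in>T. (c a i - c a0 i + real (m i)) *\<^sub>R v i)" if "a \<in> A'" for a m
  proof -
    have "a = (\<Sum>i\<in>T. c a i *\<^sub>R v i)" "a0 = (\<Sum>i\<in>T. c a0 i *\<^sub>R v i)"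
      using c that a0 A'(1) by blast+
    then have "g (a, m) = (\<Sum>i\<in>T. c a i *\<^sub>R v i) - (\<Sum>i\<in>T. c a0 i *\<^sub>R v i) + (\<Sum>i\<in>T. real (m i) *\<^sub>R v i)"
      by (simp add: g_def)
    then show ?thesis
      by (simp add: scaleR_left_distrib scaleR_left_diff_distrib sum.distrib sum_subtractf)
  qed
  have inj: "inj_on g (A' \<times> M)"
  proof (rule inj_onI, clarify)
    fix a m b l assume ab: "a \<in> A'" "b \<in> A'" and ml: "m \<in> M" "l \<in> M" and eq: "g (a, m) = g (b, l)"
    have "(\<Sum>i\<in>T. ((c a i - c b i) + (real (m i) - real (l i))) *\<^sub>R v i) = g (a, m) - g (b, l)"
      unfolding g[OF ab(1)] g[OF ab(2)] sum_subtractf [symmetric] scaleR_left_diff_distrib [symmetric]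
      by (simp add: algebra_simps)
    then have 0: "(c a i - c b i) + (real (m i) - real (l i)) = 0" if "i \<in> T" for i
      using indep[rule_format, OF _ that, of "\<lambda>i. (c a i - c b i) + (real (m i) - real (l i))"] eq by simp
    \<comment> \<open>The integer \<open>m i - l i\<close> is smaller than
      \<open>\<epsilon> \<le> 1\<close> in absolute value, hence 0.\<close>
    have *: "m i = l i" if "i \<in> T" for i
      using 0[OF that] close[OF ab that] \<epsilon>(2) by linarith
    then have "m = l"
      using ml by (auto simp: M_def intro: PiE_ext)
    moreover have "a = b"
    proof -
      have "c a i = c b i" if "i \<in> T" for i
        using 0[OF that] *[OF that] by simp
      then have "(\<Sum>i\<in>T. c a i *\<^sub>R v i) = (\<Sum>i\<in>T. c b i *\<^sub>R v i)"
        by simp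
      then show ?thesis
        using c ab A'(1) by (metis subsetD)
    qed
    ultimately show "a = b \<and> m = l" by simp
  qed
  show ?thesis
  proof (rule that[of "g ` (A' \<times> M)"])
    show "finite (g ` (A' \<times> M))"
      using A'(2) unfolding M_def by (intro finite_imageI finite_cartesian_product finite_PiE) auto
    show "g ` (A' \<times> M) \<subseteq> L"
      using A'(1) A(2) a0 v by (auto simp: g_def intro!: Ladd diff Lsum Lmult)
  next
    fix x j assume "x \<in> g ` (A' \<times> M)"
    then obtain a m where am: "a \<in> A'" "m \<in> M" "x = g (a, m)" by auto
    have \<eta>: "\<eta> $ j \<ge> 0"
      using False A(3)[of _ j] abs_ge_zero by (metis all_not_in_conv order_trans)
    have "\<bar>x $ j\<bar> = \<bar>\<Sum>i\<in>T. (c a i - c a0 i + real (m i)) * v i $ j\<bar>"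
      by (simp add: am(3) g[OF am(1)])
    also have "\<dots> \<le> (\<Sum>i\<in>T. \<bar>c a i - c a0 i + real (m i)\<bar> * \<bar>v i $ j\<bar>)"
      by (rule order_trans[OF sum_abs]) (simp add: abs_mult)
    also have "\<dots> \<le> (\<Sum>i\<in>T. (\<kappa> / d) * \<eta> $ j)"
    proof (intro sum_mono mult_mono)
      fix i assume i: "i \<in> T"
      have "m i < n" using am(2) i by (auto simp: M_def)
      then have "real (m i) \<le> real n - 1" by linarith
      then show "\<bar>c a i - c a0 i + real (m i)\<bar> \<le> \<kappa> / d"
        using close[OF am(1) a0 i] n(2) by linarith
      show "\<bar>v i $ j\<bar> \<le> \<eta> $ j" using A(3) v i by blast
    qed (use \<kappa> d in auto)
    also have "\<dots> = real (card T) * ((\<kappa> / d) * \<eta> $ j)" by simp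
    also have "\<dots> \<le> d * ((\<kappa> / d) * \<eta> $ j)"
      using \<kappa> d \<eta> card_mono[of UNIV T] by (intro mult_right_mono) (auto simp: d_def)
    also have "\<dots> = \<kappa> * \<eta> $ j" using d by simp
    finally show "\<bar>x $ j\<bar> \<le> \<kappa> * \<eta> $ j" .
  next
    \<comment> \<open>The 8 is the 4 from counting cells times the 2 lost in the choice of
      \<open>n\<close>.\<close>
    have "\<kappa> / (8 * d) \<le> (\<epsilon> / 4) * real n"
      using n(3) by (simp add: field_simps)
    then have "real (card A) * (\<kappa> / (8 * d)) ^ dim A \<le> real (card A) * ((\<epsilon> / 4) * real n) ^ dim A"
      using \<kappa> d by (intro mult_left_mono power_mono) auto
    also have "\<dots> \<le> real (card A') * real n ^ dim A"
      using mult_right_mono[OF A'_card, of "real n ^ dim A"] by (simp only: power_mult_distrib mult.assoc of_nat_0_le_iff zero_le_power)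
    also have "\<dots> = real (card (g ` (A' \<times> M)))"
      unfolding card_image[OF inj] by (simp add: card_cartesian_product M_def card_PiE T)
    finally show "real (card A) * (\<kappa> / (8 * real CARD('d))) ^ dim A \<le> real (card (g ` (A' \<times> M)))"
      by (simp only: d_def)
  qed
qed

section \<open>Dual lattice and large sieve: upper bound for the number of lattice points\<close>

text \<open>
  All fibres of \<open>u \<mapsto> a \<cdot> u mod p\<close> inject by translation into the zero fibre.
\<close>
lemma card_dual_residues_ge:
  fixes a :: "'d::finite \<Rightarrow> int" and p :: nat
  assumes p: "p > 0"
  shows "p ^ CARD('d) \<le> p * card {u \<in> UNIV \<rightarrow>\<^sub>E {0..<int p}. [(\<Sum>i\<in>UNIV. a i * u i) = 0] (mod int p)}"
    (is "_ \<le> _ * card ?U")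
proof -
  let ?P = "(UNIV :: 'd set) \<rightarrow>\<^sub>E {0..<int p}"
  let ?f = "\<lambda>u. (\<Sum>i\<in>UNIV. a i * u i) mod int p"
  have finP: "finite ?P" by (intro finite_PiE) auto
  have "?f \<in> ?P \<rightarrow> {0..<int p}" using p by auto
  then obtain y where y: "card ?P \<le> card (?f -` {y} \<inter> ?P) * p"
    using pigeonhole_card[of ?f ?P "{0..<int p}"] finP p by auto
  have "card ?P > 0" using p by (simp add: card_PiE)
  then have "?f -` {y} \<inter> ?P \<noteq> {}" using y by (intro notI) simp
  then obtain u0 where u0: "?f u0 = y" by blast
  \<comment> \<open>Subtracting a point of the same fibre makes the linear form vanish modulo
    \<open>p\<close>; the reduction returns to the cube of residues.\<close>
  define s where "s u = (\<lambda>i. (u i - u0 i) mod int p)" for u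
  have "card (?f -` {y} \<inter> ?P) \<le> card ?U"
  proof (rule card_inj_on_le)
    show "inj_on s (?f -` {y} \<inter> ?P)"
    proof (rule inj_onI)
      fix u w assume uw: "u \<in> ?f -` {y} \<inter> ?P" "w \<in> ?f -` {y} \<inter> ?P" "s u = s w"
      show "u = w"
      proof
        fix i
        have "[u i - u0 i = w i - u0 i] (mod int p)"
          using fun_cong[OF uw(3), of i] by (simp add: s_def cong_def)
        then have "[u i = w i] (mod int p)"
          using cong_add_rcancel[of "u i" "- u0 i" "w i"] by simp
        moreover have "u i \<in> {0..<int p}" "w i \<in> {0..<int p}" using uw by auto
        ultimately show "u i = w i" by (simp add: cong_def)
      qed
    qed
    show "s ` (?f -` {y} \<inter> ?P) \<subseteq> ?U"
    proof (rule image_subsetI)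
      fix u assume u: "u \<in> ?f -` {y} \<inter> ?P"
      have "[(\<Sum>i\<in>UNIV. a i * s u i) = (\<Sum>i\<in>UNIV. a i * (u i - u0 i))] (mod int p)"
        unfolding s_def by (intro cong_sum cong_mult cong_refl) (simp add: cong_def)
      also have "(\<Sum>i\<in>UNIV. a i * (u i - u0 i)) = (\<Sum>i\<in>UNIV. a i * u i) - (\<Sum>i\<in>UNIV. a i * u0 i)"
        by (simp add: right_diff_distrib sum_subtractf)
      also have "[\<dots> = 0] (mod int p)"
        using u u0 by (simp add: cong_0_iff flip: mod_eq_dvd_iff)
      finally show "s u \<in> ?U" using p by (simp add: s_def PiE_UNIV_domain)
    qed
    show "finite ?U" using finP by simp
  qed
  then have "p * card (?f -` {y} \<inter> ?P) \<le> p * card ?U" by (rule mult_le_mono2)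
  moreover have "card ?P \<le> p * card (?f -` {y} \<inter> ?P)"
    using y by (subst mult.commute)
  ultimately have "card ?P \<le> p * card ?U" by (rule order_trans[rotated])
  then show ?thesis
    by (simp add: card_PiE)
qed

lemma cis_add_Ints: "n \<in> \<int> \<Longrightarrow> cis (2 * pi * (x + n)) = cis (2 * pi * x)"
  by (simp add: distrib_left flip: cis_mult)

text \<open>A sixth of a turn is where the cosine falls to 1/2. This is the source of the 6 in the
  size bounds for lattice points.\<close>

lemma cos_two_pi_ge_half:
  fixes x :: real
  assumes "\<bar>x\<bar> \<le> 1 / 6"
  shows "cos (2 * pi * x) \<ge> 1 / 2"
proof -
  have "2 * pi * \<bar>x\<bar> \<le> pi / 3"
    using mult_left_mono[OF assms, of "2 * pi"] by simp
  then have "cos (pi / 3) \<le> cos (2 * pi * \<bar>x\<bar>)"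
    by (intro cos_monotone_0_pi_le) auto
  then show ?thesis
    by (cases "x \<ge> 0") (auto simp: cos_60)
qed

text \<open>
  The hypothesis says that the translates of a box of side lengths \<open>2 K / \<eta>\<^sub>i\<close> by the dual lattice
  are disjoint. On the \<open>1 / m\<close>-grid points of these translates the exponential sum over \<open>X\<close> has
  modulus at least \<open>card X / 2\<close>, which is compared with Parseval's identity modulo \<open>p * m\<close>.
\<close>
lemma card_bohr_lattice_subset_le:
  fixes a :: "int ^ 'd" and \<eta> :: "real ^ 'd" and K :: real and p :: nat
  assumes p: "p > 0" and K: "K > 0" and \<eta>: "\<And>i. 0 < \<eta> $ i"
    and dual: "\<And>u :: int ^ 'd. \<lbrakk>[(\<Sum>i\<in>UNIV. a $ i * u $ i) = 0] (mod int p);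
      \<And>i. \<bar>real_of_int (u $ i)\<bar> \<le> 2 * K / \<eta> $ i\<rbrakk> \<Longrightarrow> u = 0"
    and X: "finite X" "X \<subseteq> bohr_lattice p a"
      "\<And>x i. x \<in> X \<Longrightarrow> \<bar>x $ i\<bar> \<le> 1 / (6 * real CARD('d) * K) * \<eta> $ i"
  shows "real (card X) * K ^ CARD('d) \<le> 4 * real p * (\<Prod>i\<in>UNIV. \<eta> $ i)"
proof (cases "X = {}")
  case True
  then show ?thesis using \<eta> by (simp add: prod_nonneg less_imp_le)
next
  case False
  let ?d = "CARD('d)"
  \<comment> \<open>\<open>m\<close> exceeds every \<open>\<eta> $ i / K\<close>, so that the scaled
    points \<open>k x\<close> of \<open>X\<close> stay distinct modulo
    \<open>q = p * m\<close>.\<close>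
  obtain m :: nat where m: "(\<Sum>i\<in>UNIV. \<eta> $ i) / K < real m"
    using reals_Archimedean2 by blast
  have \<eta>m: "\<eta> $ i / K < real m" for i
  proof -
    have "\<eta> $ i \<le> (\<Sum>i\<in>UNIV. \<eta> $ i)"
      using \<eta> by (intro member_le_sum) (auto intro: less_imp_le)
    then have "\<eta> $ i / K \<le> (\<Sum>i\<in>UNIV. \<eta> $ i) / K"
      using K by (simp add: divide_right_mono)
    then show ?thesis using m by simp
  qed
  have m0: "m > 0"
    using \<eta>m[of undefined] \<eta>[of undefined] K by (cases m) (auto simp: divide_less_0_iff)
  define q where "q = p * m"
  have q: "q > 0" using p m0 by (simp add: q_def)
  have X_lattice: "\<exists>z y. \<forall>i. x $ i = of_int (z i) + of_int (a $ i * y) / real p" if "x \<in> X" for x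
    using X(2) that by (force simp: bohr_lattice_def)
  \<comment> \<open>Lattice points have coordinates that are multiples of \<open>1 / p\<close>, so
    the floor is exact on \<open>X\<close>.\<close>
  define k where "k x = (\<lambda>i. \<lfloor>real p * x $ i\<rfloor>)" for x :: "real ^ 'd"
  have k: "real_of_int (k x i) = real p * x $ i" if xX: "x \<in> X" for x i
  proof -
    obtain z y where "x $ i = of_int (z i) + of_int (a $ i * y) / real p"
      using X_lattice[OF xX] by blast
    then have "real p * x $ i = of_int (int p * z i + a $ i * y)"
      using p by (simp add: field_simps)
    then show ?thesis by (simp only: k_def floor_of_int)
  qed
  \<comment> \<open>As \<open>k x i / q = x $ i / m\<close>, this is the modulus of the exponential
    sum over \<open>X\<close> at the frequency \<open>w / m\<close>.\<close>
  define F where "F w = cmod (\<Sum>x\<in>X. cis (2 * pi * (\<Sum>i\<in>UNIV. of_int (w i) * of_int (k x i) / real q)))" for w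
  let ?Q = "(UNIV :: 'd set) \<rightarrow>\<^sub>E {0..<int q}"
  have "(\<Sum>w\<in>?Q. (F w)\<^sup>2) = real q ^ ?d * real (card X)"
    unfolding F_def
  proof (rule parseval_residues[OF q X(1)])
    fix x y assume xy: "x \<in> X" "y \<in> X" "\<And>i. int q dvd k x i - k y i"
    have "x $ i = y $ i" for i
    proof -
      have "\<bar>x $ i - y $ i\<bar> \<le> 2 * (1 / (6 * real ?d * K) * \<eta> $ i)"
        using X(3)[OF xy(1), of i] X(3)[OF xy(2), of i] by linarith
      also have "\<dots> = (\<eta> $ i / K) * (1 / (3 * real ?d))" by simp
      also have "\<dots> \<le> (\<eta> $ i / K) * 1"
        using \<eta>[of i] K zero_less_card_finite[where 'a = 'd] by (intro mult_left_mono) (auto simp: divide_le_eq Suc_le_eq simp del: zero_less_card_finite)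
      also have "\<dots> < real m" using \<eta>m by simp
      finally have "real p * \<bar>x $ i - y $ i\<bar> < real q"
        using p by (simp add: q_def)
      moreover have "real_of_int \<bar>k x i - k y i\<bar> = real p * \<bar>x $ i - y $ i\<bar>"
        by (simp add: k xy abs_mult flip: right_diff_distrib)
      ultimately have "\<bar>k x i - k y i\<bar> < int q"
        by linarith
      then have "k x i - k y i = 0"
        using xy(3)[of i] zdvd_not_zless[of "\<bar>k x i - k y i\<bar>" "int q"] by (cases "k x i = k y i") auto
      then show ?thesis
        using k[OF xy(1), of i] k[OF xy(2), of i] p by simp
    qed
    then show "x = y" by (simp add: vec_eq_iff)
  qed
  \<comment> \<open>\<open>U\<close> represents the dual lattice modulo \<open>p\<close>, and
    \<open>W\<close> consists of the \<open>1 / m\<close>-grid points, scaled by \<open>m\<close>,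
    of the box with half side lengths \<open>K / \<eta> $ i\<close>. \<open>G\<close> adds the two
    at the scale \<open>m\<close> and reduces modulo \<open>q\<close>.\<close>
  define U where "U = {u \<in> (UNIV :: 'd set) \<rightarrow>\<^sub>E {0..<int p}. [(\<Sum>i\<in>UNIV. a $ i * u i) = 0] (mod int p)}"
  define W where "W = PiE (UNIV :: 'd set) (\<lambda>i. {- \<lfloor>real m * K / \<eta> $ i\<rfloor>..\<lfloor>real m * K / \<eta> $ i\<rfloor>})"
  define G where "G = (\<lambda>(w, u). \<lambda>i :: 'd. (w i + int m * u i) mod int q)"
  have U: "p ^ ?d \<le> p * card U"
    unfolding U_def by (rule card_dual_residues_ge[OF p])
  have W_bound: "\<bar>real_of_int (w i)\<bar> \<le> real m * K / \<eta> $ i" if "w \<in> W" for w i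
  proof -
    have "w i \<in> {- \<lfloor>real m * K / \<eta> $ i\<rfloor>..\<lfloor>real m * K / \<eta> $ i\<rfloor>}"
      using that by (auto simp: W_def)
    then show ?thesis by (simp add: abs_le_iff) linarith
  qed
  have W: "(\<Prod>i\<in>UNIV. real m * K / \<eta> $ i) \<le> real (card W)"
  proof -
    have "real (card W) = (\<Prod>i\<in>UNIV. real (nat (2 * \<lfloor>real m * K / \<eta> $ i\<rfloor> + 1)))"
      by (simp add: W_def card_PiE)
    moreover have "Y \<le> real (nat (2 * \<lfloor>Y\<rfloor> + 1))" if "Y \<ge> 0" for Y :: real
    proof -
      have "real (nat (2 * \<lfloor>Y\<rfloor> + 1)) = 2 * of_int \<lfloor>Y\<rfloor> + 1"
        using that by simp
      moreover have "0 \<le> \<lfloor>Y\<rfloor>"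
        using that by simp
      ultimately show ?thesis
        by linarith
    qed
    moreover have "0 \<le> real m * K / \<eta> $ i" for i
      using K \<eta>[of i] by simp
    ultimately show ?thesis by (auto intro!: prod_mono)
  qed
  have inj: "inj_on G (W \<times> U)"
  proof (rule inj_onI, clarify)
    fix w u w' u' assume *: "w \<in> W" "u \<in> U" "w' \<in> W" "u' \<in> U" "G (w, u) = G (w', u')"
    have "\<exists>j. w i + int m * u i - (w' i + int m * u' i) = int q * j" for i
      using fun_cong[OF *(5), of i] by (simp add: G_def mod_eq_dvd_iff dvd_def)
    then obtain j where j: "w i + int m * u i - (w' i + int m * u' i) = int q * j i" for i
      by metis
    \<comment> \<open>A collision makes \<open>w - w'\<close> equal to \<open>m * e\<close> with
      \<open>e\<close> in the dual lattice. As a difference of two points of the box,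
      \<open>e\<close> is short enough for \<open>dual\<close>.\<close>
    define e where "e = (\<chi> i. int p * j i - (u i - u' i))"
    have we: "w i - w' i = int m * e $ i" for i
      using j[of i] by (simp add: e_def q_def algebra_simps)
    have "e = 0"
    proof (rule dual)
      have "(\<Sum>i\<in>UNIV. a $ i * e $ i)
          = int p * (\<Sum>i\<in>UNIV. a $ i * j i) - ((\<Sum>i\<in>UNIV. a $ i * u i) - (\<Sum>i\<in>UNIV. a $ i * u' i))"
        by (simp add: e_def sum_distrib_left right_diff_distrib sum_subtractf mult_ac)
      moreover have "int p dvd (\<Sum>i\<in>UNIV. a $ i * u i)" "int p dvd (\<Sum>i\<in>UNIV. a $ i * u' i)"
        using * by (simp_all add: U_def cong_0_iff)
      ultimately show "[(\<Sum>i\<in>UNIV. a $ i * e $ i) = 0] (mod int p)"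
        by (simp add: cong_0_iff)
    next
      fix i
      have "real m * \<bar>real_of_int (e $ i)\<bar> = \<bar>real_of_int (w i - w' i)\<bar>"
        by (simp add: we abs_mult)
      also have "\<dots> \<le> 2 * (real m * K / \<eta> $ i)"
        using W_bound[OF *(1), of i] W_bound[OF *(3), of i] by linarith
      also have "\<dots> = real m * (2 * K / \<eta> $ i)"
        by simp
      finally show "\<bar>real_of_int (e $ i)\<bar> \<le> 2 * K / \<eta> $ i"
        using m0 by (simp only: mult_le_cancel_left_pos of_nat_0_less_iff)
    qed
    then have "w i = w' i" and pj: "int p * j i = u i - u' i" for i
      using we[of i] by (auto simp: e_def vec_eq_iff)
    moreover have "u i = u' i" for i
    proof -
      have "u i \<in> {0..<int p}" "u' i \<in> {0..<int p}" using * by (auto simp: U_def)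
      then have "u i mod int p = u i" "u' i mod int p = u' i" by auto
      moreover have "u i mod int p = u' i mod int p"
        unfolding mod_eq_dvd_iff pj [symmetric] by simp
      ultimately show ?thesis by metis
    qed
    ultimately show "w = w' \<and> u = u'" by auto
  qed
  have F_ge: "(real (card X) / 2)\<^sup>2 \<le> (F (G (w, u)))\<^sup>2" if wu: "w \<in> W" "u \<in> U" for w u
  proof -
    have "1 / 2 \<le> Re (cis (2 * pi * (\<Sum>i\<in>UNIV. of_int (G (w, u) i) * of_int (k x i) / real q)))" if x: "x \<in> X" for x
    proof -
      obtain z y where zy: "x $ i = of_int (z i) + of_int (a $ i * y) / real p" for i
        using X_lattice[OF x] by blast
      \<comment> \<open>The phase is \<open>s + N\<close> with \<open>N\<close> an integer: the
        pairing of \<open>u\<close> with \<open>x\<close> is integral by duality, and the reduction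
        modulo \<open>q\<close> in \<open>G\<close> changes the phase by integer multiples of
        \<open>k x i\<close>. Only the small contribution \<open>s\<close> of the box
        remains.\<close>
      define s where "s = (\<Sum>i\<in>UNIV. of_int (w i) * x $ i / real m)"
      define N where "N = (\<Sum>i\<in>UNIV. u i * z i) + (\<Sum>i\<in>UNIV. a $ i * u i) div int p * y
        - (\<Sum>i\<in>UNIV. (w i + int m * u i) div int q * k x i)"
      have "(\<Sum>i\<in>UNIV. of_int (u i) * x $ i) = of_int (\<Sum>i\<in>UNIV. u i * z i) + of_int ((\<Sum>i\<in>UNIV. a $ i * u i) * y) / real p"
        by (simp add: zy distrib_left sum.distrib sum_distrib_left sum_divide_distrib mult_ac)
      also have "of_int ((\<Sum>i\<in>UNIV. a $ i * u i) * y) / real p = of_int ((\<Sum>i\<in>UNIV. a $ i * u i) div int p * y)"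
      proof -
        have "int p dvd (\<Sum>i\<in>UNIV. a $ i * u i)" using wu by (simp add: U_def cong_0_iff)
        then obtain b where "(\<Sum>i\<in>UNIV. a $ i * u i) = int p * b" by (elim dvdE)
        then show ?thesis using p by simp
      qed
      finally have ux: "(\<Sum>i\<in>UNIV. of_int (u i) * x $ i) = of_int (\<Sum>i\<in>UNIV. u i * z i) + of_int ((\<Sum>i\<in>UNIV. a $ i * u i) div int p * y)" .
      have "real_of_int (G (w, u) i) * of_int (k x i) / real q
          = of_int (w i) * x $ i / real m + of_int (u i) * x $ i - of_int ((w i + int m * u i) div int q * k x i)" for i
      proof -
        have "real_of_int (G (w, u) i) = of_int (w i) + real m * of_int (u i) - real q * of_int ((w i + int m * u i) div int q)"
          by (simp add: G_def minus_mult_div_eq_mod [symmetric])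
        then have "real_of_int (G (w, u) i) * of_int (k x i) / real q
          = (of_int (w i) + real m * of_int (u i)) * of_int (k x i) / real q - of_int ((w i + int m * u i) div int q * k x i)"
          using q by (simp add: left_diff_distrib diff_divide_distrib)
        also have "(of_int (w i) + real m * of_int (u i)) * of_int (k x i) / real q = of_int (w i) * x $ i / real m + of_int (u i) * x $ i"
          using p m0 by (simp add: k[OF x] q_def field_simps)
        finally show ?thesis .
      qed
      then have "(\<Sum>i\<in>UNIV. of_int (G (w, u) i) * of_int (k x i) / real q) = s + of_int N"
        by (simp add: sum.distrib sum_subtractf ux s_def N_def)
      then have "Re (cis (2 * pi * (\<Sum>i\<in>UNIV. of_int (G (w, u) i) * of_int (k x i) / real q))) = cos (2 * pi * s)"
        by (simp only: cis_add_Ints[OF Ints_of_int] cis.sel)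
      moreover have "\<bar>s\<bar> \<le> 1 / 6"
      proof -
        have "\<bar>s\<bar> \<le> (\<Sum>i\<in>UNIV. \<bar>of_int (w i) * x $ i / real m\<bar>)"
          unfolding s_def by (rule sum_abs)
        also have "\<dots> \<le> (\<Sum>i\<in>(UNIV :: 'd set). 1 / (6 * real ?d))"
        proof (rule sum_mono)
          fix i
          have "\<bar>of_int (w i) * x $ i\<bar> \<le> (real m * K / \<eta> $ i) * (1 / (6 * real ?d * K) * \<eta> $ i)"
            unfolding abs_mult using W_bound[OF wu(1)] X(3)[OF x] \<eta>[of i] K by (intro mult_mono) auto
          also have "\<dots> = real m * (1 / (6 * real ?d))"
            using \<eta>[of i] K by (simp add: field_simps)
          finally show "\<bar>of_int (w i) * x $ i / real m\<bar> \<le> 1 / (6 * real ?d)"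
            using m0 by (simp add: abs_divide divide_le_eq mult.commute)
        qed
        also have "\<dots> = 1 / 6" by simp
        finally show ?thesis .
      qed
      ultimately show ?thesis by (simp only: cos_two_pi_ge_half)
    qed
    then have "(\<Sum>x\<in>X. 1 / 2) \<le> Re (\<Sum>x\<in>X. cis (2 * pi * (\<Sum>i\<in>UNIV. of_int (G (w, u) i) * of_int (k x i) / real q)))"
      unfolding Re_sum by (rule sum_mono)
    also have "\<dots> \<le> F (G (w, u))"
      unfolding F_def by (rule complex_Re_le_cmod)
    finally show ?thesis by (intro power_mono) auto
  qed
  \<comment> \<open>Since \<open>G\<close> is injective, the large values of \<open>F\<close> occur
    at distinct frequencies and their squares add up to at most the Parseval sum.\<close>
  have "real (card W) * real (card U) * (real (card X) / 2)\<^sup>2 = (\<Sum>wu\<in>W \<times> U. (real (card X) / 2)\<^sup>2)"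
    by (simp add: card_cartesian_product)
  also have "\<dots> \<le> (\<Sum>wu\<in>W \<times> U. (F (G wu))\<^sup>2)"
    using F_ge by (intro sum_mono) auto
  also have "\<dots> = (\<Sum>w\<in>G ` (W \<times> U). (F w)\<^sup>2)"
    by (simp add: sum.reindex[OF inj])
  also have "\<dots> \<le> (\<Sum>w\<in>?Q. (F w)\<^sup>2)"
    using q by (intro sum_mono2) (auto simp: G_def intro!: finite_PiE)
  also have "\<dots> = real q ^ ?d * real (card X)" by fact
  finally have "real (card X) * (real (card W) * real (card U) * real (card X)) \<le> real (card X) * (4 * real q ^ ?d)"
    by (simp add: power2_eq_square mult_ac)
  moreover have "real (card X) > 0" using False X(1) by (simp add: card_gt_0_iff)
  ultimately have main: "real (card W) * real (card U) * real (card X) \<le> 4 * real q ^ ?d"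
    by (simp only: mult_le_cancel_left_pos)
  have P: "(\<Prod>i\<in>UNIV. \<eta> $ i) > 0" using \<eta> by (simp add: prod_pos)
  \<comment> \<open>\<open>W\<close> supplies a factor \<open>m ^ d\<close> and \<open>U\<close> at
    least \<open>p ^ d / p\<close>. Against \<open>q ^ d\<close> the powers of \<open>m\<close>
    cancel and a single factor \<open>p\<close> survives.\<close>
  have "(real m ^ ?d * real p ^ ?d) * (real (card X) * K ^ ?d)
      = (\<Prod>i\<in>UNIV. real m * K / \<eta> $ i) * (\<Prod>i\<in>UNIV. \<eta> $ i) * real (p ^ ?d) * real (card X)"
    using less_imp_neq[OF \<eta>] by (simp add: prod_dividef power_mult_distrib)
  also have "\<dots> \<le> real (card W) * (\<Prod>i\<in>UNIV. \<eta> $ i) * real (p * card U) * real (card X)"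
    using W P U by (intro mult_right_mono mult_mono) (auto simp del: of_nat_mult of_nat_power)
  also have "\<dots> = (real p * (\<Prod>i\<in>UNIV. \<eta> $ i)) * (real (card W) * real (card U) * real (card X))"
    by simp
  also have "\<dots> \<le> (real p * (\<Prod>i\<in>UNIV. \<eta> $ i)) * (4 * real q ^ ?d)"
    using main P by (intro mult_left_mono) auto
  also have "\<dots> = (real m ^ ?d * real p ^ ?d) * (4 * real p * (\<Prod>i\<in>UNIV. \<eta> $ i))"
    by (simp add: q_def power_mult_distrib)
  finally show ?thesis
    using p m0 by (simp add: mult_le_cancel_left_pos)
qed

section \<open>The Bohr set and the quantities \<open>t\<close> and \<open>\<delta>\<close>\<close>

lemma bohr_lattice_diff:
  assumes "x \<in> bohr_lattice p a" "y \<in> bohr_lattice p a"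
  shows "x - y \<in> bohr_lattice p a"
proof -
  obtain z r z' r' where
    "x = (\<chi> i. real_of_int (z $ i)) + (\<chi> i. real_of_int (a $ i * r) / real p)"
    "y = (\<chi> i. real_of_int (z' $ i)) + (\<chi> i. real_of_int (a $ i * r') / real p)"
    using assms by (auto simp: bohr_lattice_def)
  then have "x - y = (\<chi> i. real_of_int ((z - z') $ i)) + (\<chi> i. real_of_int (a $ i * (r - r')) / real p)"
    by (simp add: vec_eq_iff algebra_simps diff_divide_distrib)
  then show ?thesis unfolding bohr_lattice_def by blast
qed

text \<open>The maximum is attained by a basis of the span chosen inside the set.\<close>

lemma bohr_t_eq_dim:
  fixes \<eta> :: "real ^ 'd"
  shows "bohr_t p a \<eta> = dim (bohr_box \<eta> \<inter> bohr_lattice p a)" (is "_ = dim ?A")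
  unfolding bohr_t_def
proof (rule Max_eqI)
  show "finite {t. t \<le> CARD('d) \<and> (\<exists>S. finite S \<and> card S = t \<and> S \<subseteq> ?A \<and> independent S)}"
    by (rule finite_subset[of _ "{..CARD('d)}"]) auto
next
  fix t assume "t \<in> {t. t \<le> CARD('d) \<and> (\<exists>S. finite S \<and> card S = t \<and> S \<subseteq> ?A \<and> independent S)}"
  then show "t \<le> dim ?A" by (auto intro: independent_card_le_dim)
next
  obtain S where "S \<subseteq> ?A" "independent S" "?A \<subseteq> span S" "card S = dim ?A"
    by (rule basis_exists)
  then show "dim ?A \<in> {t. t \<le> CARD('d) \<and> (\<exists>S. finite S \<and> card S = t \<and> S \<subseteq> ?A \<and> independent S)}"
    using dim_subset_UNIV_cart[of ?A] finiteI_independent by auto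
qed

text \<open>The injection sends \<open>x\<close> to the vector of signed distances from
  \<open>a $ i * x / p\<close> to the nearest integer. A single coordinate already determines
  \<open>x\<close>, because \<open>a $ i\<close> is invertible modulo \<open>p\<close>.\<close>

lemma card_bohr_set_le:
  fixes a :: "int ^ 'd"
  assumes p: "prime p" and a: "\<And>i. a $ i \<in> carrier (residue_ring (int p)) - {0}"
    and fin: "finite (bohr_box \<eta> \<inter> bohr_lattice p a)"
  shows "card (bohr_set p a \<eta>) \<le> card (bohr_box \<eta> \<inter> bohr_lattice p a)"
proof (rule card_inj_on_le[OF _ _ fin])
  let ?r = "\<lambda>x i. round (real_of_int (a $ i * x) / real p)"
  let ?f = "\<lambda>x. \<chi> i. real_of_int (a $ i * x) / real p - of_int (?r x i)"
  have p0: "p > 0" using p by (simp add: prime_gt_0_nat)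
  show "inj_on ?f (bohr_set p a \<eta>)"
  proof (rule inj_onI)
    fix x y assume "x \<in> bohr_set p a \<eta>" "y \<in> bohr_set p a \<eta>" and eq: "?f x = ?f y"
    then have xy: "x \<in> {0..<int p}" "y \<in> {0..<int p}"
      by (auto simp: bohr_set_def residue_ring_def)
    \<comment> \<open>Any coordinate will do; the index type is nonempty.\<close>
    obtain i :: 'd where True by simp
    have "real_of_int (a $ i * x) / real p - of_int (?r x i) = real_of_int (a $ i * y) / real p - of_int (?r y i)"
      using eq by (simp add: vec_eq_iff)
    then have "real_of_int (a $ i * (x - y)) = real_of_int (int p * (?r x i - ?r y i))"
      using p0 by (simp add: field_simps)
    then have "a $ i * (x - y) = int p * (?r x i - ?r y i)"
      by (simp only: of_int_eq_iff)
    then have "int p dvd a $ i * (x - y)"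
      by simp
    moreover have "\<not> int p dvd a $ i"
      using a[of i] by (auto simp: residue_ring_def dest: zdvd_imp_le)
    ultimately have "int p dvd x - y"
      using p by (simp add: prime_dvd_mult_iff)
    then have "x mod int p = y mod int p"
      by (simp add: mod_eq_dvd_iff)
    then show "x = y"
      using xy by simp
  qed
  show "?f ` bohr_set p a \<eta> \<subseteq> bohr_box \<eta> \<inter> bohr_lattice p a"
  proof (intro image_subsetI IntI)
    fix x assume "x \<in> bohr_set p a \<eta>"
    then have abs_le: "\<bar>?f x $ i\<bar> \<le> \<eta> $ i" for i
      by (simp add: bohr_set_def dist_nearest_int_def)
    have "- \<eta> $ i \<le> ?f x $ i \<and> ?f x $ i \<le> \<eta> $ i" for i
      using abs_le[of i] by linarith
    then show "?f x \<in> bohr_box \<eta>"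
      unfolding bohr_box_def mem_box_cart vector_uminus_component by blast
    have "?f x = (\<chi> i. real_of_int ((\<chi> i. - ?r x i) $ i)) + (\<chi> i. real_of_int (a $ i * x) / real p)"
      by (simp add: vec_eq_iff)
    then show "?f x \<in> bohr_lattice p a"
      unfolding bohr_lattice_def by blast
  qed
qed

text \<open>The set \<open>D\<close> under the supremum contains half the least
  \<open>\<eta> $ i\<close>, for which all bounds on \<open>u\<close> are below 1. It is bounded
  above by \<open>p\<close>, since the vector with all entries \<open>p\<close> solves the
  congruence. It is closed downwards, so every \<open>s\<close> below the supremum admits only the
  trivial solution.\<close>

lemma
  fixes a :: "int ^ 'd" and \<eta> :: "real ^ 'd"
  assumes p: "p > 0" and \<eta>: "\<And>i. 0 < \<eta> $ i" "\<And>i. \<eta> $ i < 1"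
  shows bohr_delta_pos: "bohr_delta p a \<eta> > 0"
    and zero_if_less_bohr_delta: "\<And>s u. \<lbrakk>s < bohr_delta p a \<eta>; [(\<Sum>i\<in>UNIV. a $ i * u $ i) = 0] (mod int p);
      \<And>i. \<bar>real_of_int (u $ i)\<bar> \<le> s / \<eta> $ i\<rbrakk> \<Longrightarrow> u = 0"
proof -
  define D where "D = {\<delta> :: real. \<forall>u :: int ^ 'd. [(\<Sum>i\<in>UNIV. a $ i * u $ i) = 0] (mod int p)
    \<and> (\<forall>i. \<bar>real_of_int (u $ i)\<bar> \<le> \<delta> / \<eta> $ i) \<longrightarrow> u = 0}"
  have delta: "bohr_delta p a \<eta> = Sup D"
    by (simp add: bohr_delta_def D_def)
  have less: "\<delta> < real p" if "\<delta> \<in> D" for \<delta>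
  proof (rule ccontr)
    assume "\<not> \<delta> < real p"
    then have \<delta>: "\<delta> \<ge> real p" by simp
    define u :: "int ^ 'd" where "u = (\<chi> i. int p)"
    have "real p \<le> \<delta> / \<eta> $ i" for i
    proof -
      have "real p * \<eta> $ i \<le> \<delta> * 1"
        using \<delta> \<eta>[of i] by (intro mult_mono) auto
      then show ?thesis using \<eta>(1)[of i] by (simp add: le_divide_eq)
    qed
    moreover have "[(\<Sum>i\<in>UNIV. a $ i * u $ i) = 0] (mod int p)"
      by (auto simp: u_def cong_0_iff intro: dvd_sum)
    ultimately have "u = 0"
      using that by (simp add: D_def u_def)
    then show False using p by (simp add: u_def vec_eq_iff)
  qed
  then have bdd: "bdd_above D"
    by (meson bdd_above.I less_imp_le)
  define \<epsilon> where "\<epsilon> = Min (range (($) \<eta>))"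
  have \<epsilon>: "\<epsilon> > 0" "\<epsilon> \<le> \<eta> $ i" for i
    using \<eta>(1) by (auto simp: \<epsilon>_def)
  have "\<epsilon> / 2 \<in> D"
    unfolding D_def
  proof (intro CollectI allI impI, elim conjE)
    fix u :: "int ^ 'd" assume u: "\<forall>i. \<bar>real_of_int (u $ i)\<bar> \<le> \<epsilon> / 2 / \<eta> $ i"
    have "u $ i = 0" for i
    proof -
      have "\<epsilon> / 2 / \<eta> $ i < 1"
        using \<epsilon>(1) \<epsilon>(2)[of i] \<eta>(1)[of i] by (simp add: divide_less_eq)
      then have "\<bar>real_of_int (u $ i)\<bar> < 1"
        using u by (meson le_less_trans)
      then show ?thesis by linarith
    qed
    then show "u = 0" by (simp add: vec_eq_iff)
  qed
  then have "\<epsilon> / 2 \<le> Sup D" using bdd by (rule cSup_upper)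
  then show "bohr_delta p a \<eta> > 0" using \<epsilon>(1) by (simp add: delta)
  fix s u assume s: "s < bohr_delta p a \<eta>" and u: "[(\<Sum>i\<in>UNIV. a $ i * u $ i) = 0] (mod int p)"
    "\<And>i. \<bar>real_of_int (u $ i)\<bar> \<le> s / \<eta> $ i"
  obtain \<delta> where \<delta>: "\<delta> \<in> D" "s < \<delta>"
    using less_cSupD[of D s] s \<open>\<epsilon> / 2 \<in> D\<close> by (auto simp: delta)
  have "\<bar>real_of_int (u $ i)\<bar> \<le> \<delta> / \<eta> $ i" for i
    using u(2)[of i] divide_right_mono[of s \<delta> "\<eta> $ i"] \<delta>(2) \<eta>(1)[of i] by linarith
  then show "u = 0" using \<delta>(1) u(1) by (simp add: D_def)
qed

section \<open>Comparison of the two bounds\<close>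

theorem proposition3p1:
  "\<exists>C > (0 :: real). \<forall>(p :: nat) (a :: int ^ 'd) (\<eta> :: real ^ 'd).
     prime p \<longrightarrow>
     (\<forall>i. a $ i \<in> carrier (residue_ring (int p)) - {0}) \<longrightarrow>
     (\<forall>i. \<eta> $ i \<in> {0 <..< 1 / 2}) \<longrightarrow>
     real (card (bohr_set p a \<eta>))
       \<le> C * bohr_delta p a \<eta> powi (int (bohr_t p a \<eta>) - int CARD('d)) * (\<Prod>i\<in>UNIV. \<eta> $ i) * real p"
proof -
  define d where "d = CARD('d)"
  have d: "d \<ge> 1" by (simp add: d_def Suc_le_eq)
  \<comment> \<open>With \<open>K = \<delta> / 4\<close> and
    \<open>\<kappa> = 1 / (6 * d * K)\<close> below, this value makes
    \<open>\<kappa> / (8 * d)\<close> equal to \<open>1 / (b * \<delta>)\<close>.\<close>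
  define b where "b = 12 * real d ^ 2"
  have b: "b \<ge> 1"
  proof -
    have "1 \<le> real d ^ 2" using d by (intro one_le_power) simp
    then show ?thesis unfolding b_def by linarith
  qed
  have "real (card (bohr_set p a \<eta>))
      \<le> 4 * 4 ^ d * b ^ d * bohr_delta p a \<eta> powi (int (bohr_t p a \<eta>) - int d) * (\<Prod>i\<in>UNIV. \<eta> $ i) * real p"
    if prime: "prime p" and a: "\<forall>i. a $ i \<in> carrier (residue_ring (int p)) - {0}"
      and \<eta>_range: "\<forall>i. \<eta> $ i \<in> {0 <..< 1 / 2}"
    for p and a :: "int ^ 'd" and \<eta> :: "real ^ 'd"
  proof -
    have p: "p > 0" using prime by (simp add: prime_gt_0_nat)
    have \<eta>: "0 < \<eta> $ i" "\<eta> $ i < 1" for i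
      using \<eta>_range[rule_format, of i] by auto
    define A where "A = bohr_box \<eta> \<inter> bohr_lattice p a"
    have A_le: "\<bar>x $ i\<bar> \<le> \<eta> $ i" if "x \<in> A" for x i
    proof -
      have "- \<eta> $ i \<le> x $ i \<and> x $ i \<le> \<eta> $ i"
        using that by (auto simp: A_def bohr_box_def mem_box_cart)
      then show ?thesis by linarith
    qed
    define \<delta> where "\<delta> = bohr_delta p a \<eta>"
    have \<delta>: "\<delta> > 0" unfolding \<delta>_def using p \<eta> by (rule bohr_delta_pos)
    define V where "V = (\<Prod>i\<in>UNIV. \<eta> $ i)"
    have V: "V > 0" using \<eta>(1) by (simp add: V_def prod_pos)
    \<comment> \<open>The bound \<open>\<delta> / 4\<close> gives \<open>2 * K < \<delta>\<close>
      strictly, as uniqueness of the trivial solution is known only below the supremum.\<close>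
    have card_le: "real (card X) * K ^ d \<le> 4 * real p * V"
      if "0 < K" "K \<le> \<delta> / 4" "finite X" "X \<subseteq> bohr_lattice p a"
        "\<And>x i. x \<in> X \<Longrightarrow> \<bar>x $ i\<bar> \<le> 1 / (6 * real d * K) * \<eta> $ i" for X K
      unfolding d_def V_def
    proof (rule card_bohr_lattice_subset_le[OF p that(1) \<eta>(1) _ that(3,4)])
      show "u = 0" if "[(\<Sum>i\<in>UNIV. a $ i * u $ i) = 0] (mod int p)"
        "\<And>i. \<bar>real_of_int (u $ i)\<bar> \<le> 2 * K / \<eta> $ i" for u
      proof (rule zero_if_less_bohr_delta[OF p \<eta> _ that])
        show "2 * K < bohr_delta p a \<eta>"
          using \<delta> \<open>K \<le> \<delta> / 4\<close> unfolding \<delta>_def by linarith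
      qed
    qed (use that(5) in \<open>simp add: d_def\<close>)
    \<comment> \<open>A smaller \<open>K\<close> makes the exponential sum bound apply to subsets of \<open>A\<close> itself.\<close>
    have fin: "finite A"
    proof -
      define K where "K = min (\<delta> / 4) (1 / (6 * real d))"
      have K: "0 < K" "K \<le> \<delta> / 4" "K * (6 * real d) \<le> 1"
        using \<delta> d by (auto simp: K_def min_def field_simps)
      have "card G \<le> nat \<lceil>4 * real p * V / K ^ d\<rceil>" if "G \<subseteq> A" "finite G" for G
      proof -
        have "real (card G) * K ^ d \<le> 4 * real p * V"
        proof (rule card_le[OF K(1,2) that(2)])
          fix x i assume "x \<in> G"
          have "1 * \<eta> $ i \<le> 1 / (6 * real d * K) * \<eta> $ i"
            using K d \<eta>(1)[of i] by (intro mult_right_mono) (auto simp: le_divide_eq mult.commute)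
          then show "\<bar>x $ i\<bar> \<le> 1 / (6 * real d * K) * \<eta> $ i"
            using A_le[of x i] \<open>x \<in> G\<close> \<open>G \<subseteq> A\<close> by fastforce
        qed (use that in \<open>auto simp: A_def\<close>)
        then have "real (card G) \<le> 4 * real p * V / K ^ d"
          using K(1) by (simp add: le_divide_eq)
        then show ?thesis by linarith
      qed
      then show ?thesis using finite_if_finite_subsets_card_bdd by blast
    qed
    define t where "t = dim A"
    have t: "bohr_t p a \<eta> = t" "t \<le> d"
      using dim_subset_UNIV_cart[of A] by (auto simp: bohr_t_eq_dim t_def A_def d_def)
    \<comment> \<open>The largest value that \<open>card_le\<close> admits; \<open>\<kappa>\<close>
      is the matching dilation factor.\<close>
    define K where "K = \<delta> / 4"
    have K: "K > 0" using \<delta> by (simp add: K_def)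
    define \<kappa> where "\<kappa> = 1 / (6 * real d * K)"
    have \<kappa>: "\<kappa> > 0" using K d by (simp add: \<kappa>_def)
    obtain X where X: "finite X" "X \<subseteq> bohr_lattice p a" "\<And>x i. x \<in> X \<Longrightarrow> \<bar>x $ i\<bar> \<le> \<kappa> * \<eta> $ i"
      "real (card A) * (\<kappa> / (8 * real d)) ^ t \<le> real (card X)"
      unfolding t_def d_def
      by (rule ex_dilated_subset[of "bohr_lattice p a" A \<eta> \<kappa>])
        (use fin A_le \<kappa> in \<open>auto simp: A_def intro: bohr_lattice_diff\<close>)
    have "real (card A) * (1 / (b * \<delta>)) ^ t * (\<delta> / 4) ^ d \<le> real (card X) * K ^ d"
    proof -
      have "\<kappa> / (8 * real d) = 1 / (b * \<delta>)"
        by (simp add: \<kappa>_def K_def b_def power2_eq_square)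
      then show ?thesis using X(4) K by (simp add: K_def)
    qed
    also have "\<dots> \<le> 4 * real p * V"
      using K X by (intro card_le) (auto simp: K_def \<kappa>_def)
    finally have "real (card A) \<le> 4 * real p * V * (b * \<delta>) ^ t / (\<delta> / 4) ^ d"
      using \<delta> b by (simp add: field_simps)
    also have "\<dots> = 4 * 4 ^ d * b ^ t * (\<delta> ^ t / \<delta> ^ d) * V * real p"
      by (simp add: power_mult_distrib power_divide)
    \<comment> \<open>As \<open>b \<ge> 1\<close> and \<open>t \<le> d\<close>, the exponent of
      \<open>b\<close> can be raised to \<open>d\<close>, which frees the constant from
      \<open>t\<close>.\<close>
    also have "\<dots> \<le> 4 * 4 ^ d * b ^ d * (\<delta> ^ t / \<delta> ^ d) * V * real p"
      using b t(2) \<delta> V by (intro mult_right_mono mult_left_mono power_increasing) auto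
    also have "\<delta> ^ t / \<delta> ^ d = \<delta> powi (int t - int d)"
      using \<delta> by (simp add: power_int_diff)
    finally have "real (card A) \<le> 4 * 4 ^ d * b ^ d * \<delta> powi (int t - int d) * V * real p" .
    moreover have "card (bohr_set p a \<eta>) \<le> card A"
      unfolding A_def
    proof (rule card_bohr_set_le[OF prime])
      show "a $ i \<in> carrier (residue_ring (int p)) - {0}" for i
        using a by blast
    qed (use fin in \<open>simp add: A_def\<close>)
    ultimately show ?thesis
      by (simp add: t(1) \<delta>_def V_def)
  qed
  moreover have "4 * 4 ^ d * b ^ d > 0" using b by simp
  ultimately show ?thesis
    unfolding d_def by blast
qed

end
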